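(* Let $\kappa$ be a cardinal and $U$ an ultrafilter over $\kappa$. A set $X\subseteq{}^{\omega}\kappa$ is $U$-measurable if and only if there are sets $Z,Y$ with $Z\subseteq X\subseteq Y$, $Z$ an $F_\sigma$ set, $Y$ a $G_\delta$ set, and $Y\setminus Z$ $U$-null.
   Context: ${}^{\omega}\kappa$ carries the product topology of the discrete space $\kappa$. ${}^{<\omega}\kappa$ is the set of finite sequences from $\kappa$; $\frown$ is concatenation, $\langle\rangle$ the empty sequence. A tree is a subset of ${}^{<\omega}\kappa$ closed under initial segments; $[T]$ is the set of infinite branches of $T$. For $X\subseteq{}^{\omega}\kappa$ and $\sigma\in{}^{<\omega}\kappa$, $X\lfloor\sigma=\{s:\sigma\frown s\in X\}$. A tree $T$ is $U$-branching iff $\langle\rangle\in T$ and for each $\sigma\in T$, $\{\alpha\in\kappa:\sigma\frown\langle\alpha\rangle\in T\}\in U$. $X$ is $U$-large (resp. $U$-small) iff there is a $U$-branching tree $T$ with $[T]\subseteq X$ (resp. $[T]\cap X=\emptyset$); $X$ is $U$-determined iff it is $U$-large or $U$-small; $X$ is $U$-measurable iff $X\lfloor\sigma$ is $U$-determined for every $\sigma\in{}^{<\omega}\kappa$; $X$ is $U$-null iff $X\lfloor\sigma$ is $U$-small for every $\sigma\in{}^{<\omega}\kappa$. *)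

theory Defs
  imports "HOL-Analysis.Analysis" "HOL-Library.Omega_Words_Fun"
begin

text \<open>
  The set \<open>K\<close> stands for the underlying set of \<open>\<kappa>\<close>. Finite sequences from \<open>K\<close> are the elements of
  \<open>lists K\<close>, infinite ones are the elements of \<open>UNIV \<rightarrow> K\<close> with domain \<^typ>\<open>nat\<close>, and \<open>\<sigma> \<frown> s\<close> from
  \<^theory>\<open>HOL-Library.Omega_Words_Fun\<close> is the concatenation of a finite and an infinite sequence.
\<close>

definition seq_topology :: "'a set \<Rightarrow> (nat \<Rightarrow> 'a) topology" where
  "seq_topology K = product_topology (\<lambda>_. discrete_topology K) UNIV"

lemma topspace_seq_topology [simp]: "topspace (seq_topology K) = (UNIV \<rightarrow> K)"
  by (simp add: seq_topology_def PiE_UNIV_domain Pi_def)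

definition ultrafilter_over :: "'a set \<Rightarrow> 'a set set \<Rightarrow> bool" where
  "ultrafilter_over K U \<longleftrightarrow>
     U \<subseteq> Pow K \<and> K \<in> U \<and> {} \<notin> U \<and>
     (\<forall>A\<in>U. \<forall>B\<in>U. A \<inter> B \<in> U) \<and>
     (\<forall>A\<in>U. \<forall>B. A \<subseteq> B \<and> B \<subseteq> K \<longrightarrow> B \<in> U) \<and>
     (\<forall>A. A \<subseteq> K \<longrightarrow> A \<in> U \<or> K - A \<in> U)"

definition seq_tree :: "'a set \<Rightarrow> 'a list set \<Rightarrow> bool" where
  "seq_tree K T \<longleftrightarrow> T \<subseteq> lists K \<and> (\<forall>\<sigma> \<tau>. \<sigma> @ \<tau> \<in> T \<longrightarrow> \<sigma> \<in> T)"

definition branches :: "'a list set \<Rightarrow> (nat \<Rightarrow> 'a) set" where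
  "branches T = {s. \<forall>n. map s [0..<n] \<in> T}"

text \<open>
  For \<open>X \<subseteq> (UNIV \<rightarrow> K)\<close> every element of \<open>section_at X \<sigma>\<close> is again an infinite sequence from \<open>K\<close>.
\<close>

definition section_at :: "(nat \<Rightarrow> 'a) set \<Rightarrow> 'a list \<Rightarrow> (nat \<Rightarrow> 'a) set" where
  "section_at X \<sigma> = {s. \<sigma> \<frown> s \<in> X}"

definition U_branching :: "'a set \<Rightarrow> 'a set set \<Rightarrow> 'a list set \<Rightarrow> bool" where
  "U_branching K U T \<longleftrightarrow>
     seq_tree K T \<and> [] \<in> T \<and> (\<forall>\<sigma>\<in>T. {\<alpha>\<in>K. \<sigma> @ [\<alpha>] \<in> T} \<in> U)"

definition U_large :: "'a set \<Rightarrow> 'a set set \<Rightarrow> (nat \<Rightarrow> 'a) set \<Rightarrow> bool" where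
  "U_large K U X \<longleftrightarrow> (\<exists>T. U_branching K U T \<and> branches T \<subseteq> X)"

definition U_small :: "'a set \<Rightarrow> 'a set set \<Rightarrow> (nat \<Rightarrow> 'a) set \<Rightarrow> bool" where
  "U_small K U X \<longleftrightarrow> (\<exists>T. U_branching K U T \<and> branches T \<inter> X = {})"

definition U_determined :: "'a set \<Rightarrow> 'a set set \<Rightarrow> (nat \<Rightarrow> 'a) set \<Rightarrow> bool" where
  "U_determined K U X \<longleftrightarrow> U_large K U X \<or> U_small K U X"

definition U_measurable :: "'a set \<Rightarrow> 'a set set \<Rightarrow> (nat \<Rightarrow> 'a) set \<Rightarrow> bool" where
  "U_measurable K U X \<longleftrightarrow> (\<forall>\<sigma>\<in>lists K. U_determined K U (section_at X \<sigma>))"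

definition U_null :: "'a set \<Rightarrow> 'a set set \<Rightarrow> (nat \<Rightarrow> 'a) set \<Rightarrow> bool" where
  "U_null K U X \<longleftrightarrow> (\<forall>\<sigma>\<in>lists K. U_small K U (section_at X \<sigma>))"

end

theory Submission
  imports Defs
begin

text \<open>
  If \<open>X\<close> is measurable, choose at every node \<open>\<sigma>\<close> a branching tree inside or outside the section of
  \<open>X\<close> at \<open>\<sigma>\<close>. For a fixed length of \<open>\<sigma>\<close> the shifted branch sets lie in disjoint cylinders, so
  their union is closed; taking all lengths gives an \<open>F\<^sub>\<sigma>\<close> set \<open>Z \<subseteq> X\<close>, and dually the \<open>G\<^sub>\<delta>\<close> set \<open>Y\<close>.

  Conversely it suffices that \<open>F\<^sub>\<sigma>\<close> sets are measurable. If \<open>\<Union>n. C n\<close> with closed \<open>C n\<close> is not large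
  at a node, then almost every successor has the same property, and there each \<open>C n\<close> is
  small, being determined and not large. Start avoiding \<open>C n\<close> only at level \<open>n\<close>: then each node has
  finitely many constraints on its successors, so no completeness of \<open>U\<close> is needed.
\<close>

section \<open>Sections, large and small sets, prefixes and suffixes\<close>

lemma section_at_append: "section_at X (\<sigma> @ \<tau>) = section_at (section_at X \<sigma>) \<tau>"
  by (auto simp: section_at_def)

lemma section_at_Compl: "section_at (- X) \<sigma> = - section_at X \<sigma>"
  by (auto simp: section_at_def)

lemma section_at_mono: "X \<subseteq> Y \<Longrightarrow> section_at X \<sigma> \<subseteq> section_at Y \<sigma>"
  by (auto simp: section_at_def)

text \<open>The duality that turns results on largeness into results on smallness. The complement
  may be taken in the whole function type, since only its intersection with branch sets
  matters.\<close>

lemma U_small_iff_large_Compl: "U_small K U X \<longleftrightarrow> U_large K U (- X)"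
  unfolding U_small_def U_large_def by (metis disjoint_eq_subset_Compl)

lemma U_large_mono: "U_large K U X \<Longrightarrow> X \<subseteq> Y \<Longrightarrow> U_large K U Y"
  unfolding U_large_def by blast

lemma U_small_mono: "U_small K U Y \<Longrightarrow> X \<subseteq> Y \<Longrightarrow> U_small K U X"
  unfolding U_small_def by blast

lemma conc_in_seqs: "\<sigma> \<in> lists K \<Longrightarrow> s \<in> UNIV \<rightarrow> K \<Longrightarrow> \<sigma> \<frown> s \<in> UNIV \<rightarrow> K"
  by (auto simp: conc_def in_lists_conv_set)

lemma prefix_conc_length: "length \<sigma> = n \<Longrightarrow> prefix n (\<sigma> \<frown> s) = \<sigma>"
  by (auto simp: subsequence_def conc_def intro: nth_equalityI)

lemma suffix_conc_length: "length \<sigma> = n \<Longrightarrow> suffix n (\<sigma> \<frown> s) = s"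
  by (auto simp: suffix_def conc_def)

lemma prefix_eq_iff: "prefix n s = prefix n t \<longleftrightarrow> (\<forall>i<n. s i = t i)"
  by (auto simp: subsequence_def)

lemma branches_iff: "s \<in> branches T \<longleftrightarrow> (\<forall>n. prefix n s \<in> T)"
  by (simp add: branches_def subsequence_def)

lemma branches_in_seqs:
  assumes "seq_tree K T" "s \<in> branches T"
  shows "s \<in> UNIV \<rightarrow> K"
proof
  fix i
  have "map s [0..<Suc i] \<in> lists K"
    using assms unfolding seq_tree_def branches_def by blast
  then show "s i \<in> K" by simp
qed

section \<open>Open and closed sets of sequences\<close>

text \<open>A basic open box restricts only finitely many coordinates, so it contains the cylinder
  of a long enough prefix of each of its points. Conversely, a cylinder is a box with singleton
  factors below \<open>n\<close>.\<close>

lemma openin_seq_topology_iff: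
  "openin (seq_topology K) S \<longleftrightarrow> S \<subseteq> (UNIV \<rightarrow> K) \<and>
     (\<forall>s\<in>S. \<exists>n. \<forall>t\<in>UNIV \<rightarrow> K. prefix n t = prefix n s \<longrightarrow> t \<in> S)"
    (is "?L \<longleftrightarrow> ?R")
proof
  assume L: ?L
  show ?R
  proof (intro conjI ballI)
    show "S \<subseteq> (UNIV \<rightarrow> K)"
      using openin_subset[OF L] by simp
    fix s assume "s \<in> S"
    then obtain V where V: "finite {i. V i \<noteq> K}" "\<And>i. V i \<subseteq> K" "s \<in> Pi\<^sub>E UNIV V" "Pi\<^sub>E UNIV V \<subseteq> S"
      using L unfolding seq_topology_def openin_product_topology_alt by force
    obtain n where n: "\<And>i. V i \<noteq> K \<Longrightarrow> i < n"
      using finite_nat_bounded[OF V(1)] by auto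
    have "t \<in> S" if t: "t \<in> UNIV \<rightarrow> K" "prefix n t = prefix n s" for t
    proof -
      have "t i \<in> V i" for i
        using t n[of i] V(3) by (cases "V i = K") (auto simp: prefix_eq_iff PiE_UNIV_domain)
      then show ?thesis using V(4) by (auto simp: PiE_UNIV_domain)
    qed
    then show "\<exists>n. \<forall>t\<in>UNIV \<rightarrow> K. prefix n t = prefix n s \<longrightarrow> t \<in> S" by blast
  qed
next
  assume R: ?R
  show ?L
    unfolding seq_topology_def openin_product_topology_alt
  proof
    fix s assume s: "s \<in> S"
    with R obtain n where n: "\<And>t. t \<in> UNIV \<rightarrow> K \<Longrightarrow> prefix n t = prefix n s \<Longrightarrow> t \<in> S" by blast
    define V where "V i = (if i < n then {s i} else K)" for i
    have sK: "s i \<in> K" for i using R s by auto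
    have "finite {i. V i \<noteq> K}"
      by (rule finite_subset[of _ "{..<n}"]) (auto simp: V_def)
    moreover have "Pi\<^sub>E UNIV V \<subseteq> S"
    proof
      fix t assume t: "t \<in> Pi\<^sub>E UNIV V"
      have tV: "t i \<in> V i" for i using t by auto
      have "t i \<in> K" for i using tV[of i] sK[of i] by (auto simp: V_def split: if_splits)
      moreover have "t i = s i" if "i < n" for i using tV[of i] that by (auto simp: V_def)
      ultimately show "t \<in> S" by (intro n) (auto simp: prefix_eq_iff)
    qed
    ultimately show "\<exists>V. finite {i \<in> UNIV. V i \<noteq> topspace (discrete_topology K)} \<and>
        (\<forall>i\<in>UNIV. openin (discrete_topology K) (V i)) \<and> s \<in> Pi\<^sub>E UNIV V \<and> Pi\<^sub>E UNIV V \<subseteq> S"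
      using sK by (intro exI[of _ V]) (auto simp: V_def PiE_UNIV_domain)
  qed
qed

lemma closedin_seq_topology_iff:
  "closedin (seq_topology K) C \<longleftrightarrow> C \<subseteq> (UNIV \<rightarrow> K) \<and>
     (\<forall>s\<in>(UNIV \<rightarrow> K) - C. \<exists>n. \<forall>t\<in>UNIV \<rightarrow> K. prefix n t = prefix n s \<longrightarrow> t \<notin> C)"
proof -
  have "(\<forall>t\<in>UNIV \<rightarrow> K. prefix n t = prefix n s \<longrightarrow> t \<in> (UNIV \<rightarrow> K) - C) \<longleftrightarrow>
      (\<forall>t\<in>UNIV \<rightarrow> K. prefix n t = prefix n s \<longrightarrow> t \<notin> C)" for n s
    by blast
  then show ?thesis
    unfolding closedin_def openin_seq_topology_iff topspace_seq_topology
    by (simp only: Diff_subset simp_thms)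
qed

section \<open>Grafting trees onto nodes\<close>

text \<open>This is the union over \<open>\<sigma> \<in> L\<close> of the copies of
  \<open>branches (T \<sigma>)\<close> shifted to start at \<open>\<sigma>\<close>. Cutting by the
  length \<open>n\<close> shows it as a countable union, even when \<open>L\<close> is
  uncountable.\<close>

definition grafted_branches :: "'a list set \<Rightarrow> ('a list \<Rightarrow> 'a list set) \<Rightarrow> (nat \<Rightarrow> 'a) set" where
  "grafted_branches L T = {s. \<exists>n. prefix n s \<in> L \<and> suffix n s \<in> branches (T (prefix n s))}"

lemma branches_subset_section_grafted:
  assumes "\<sigma> \<in> L"
  shows "branches (T \<sigma>) \<subseteq> section_at (grafted_branches L T) \<sigma>"
proof
  fix s assume "s \<in> branches (T \<sigma>)"
  then show "s \<in> section_at (grafted_branches L T) \<sigma>"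
    unfolding section_at_def grafted_branches_def mem_Collect_eq
    using assms
    by (intro exI[of _ "length \<sigma>"]) (simp only: prefix_conc_length[OF refl] suffix_conc_length[OF refl])
qed

lemma grafted_branches_subset:
  assumes "\<And>\<sigma>. \<sigma> \<in> L \<Longrightarrow> branches (T \<sigma>) \<subseteq> section_at X \<sigma>"
  shows "grafted_branches L T \<subseteq> X"
proof
  fix s assume "s \<in> grafted_branches L T"
  then obtain n where n: "prefix n s \<in> L" "suffix n s \<in> branches (T (prefix n s))"
    by (auto simp: grafted_branches_def)
  with assms have "prefix n s \<frown> suffix n s \<in> X"
    unfolding section_at_def by blast
  then show "s \<in> X" by simp
qed

lemma fsigma_in_grafted_branches:
  assumes L: "L \<subseteq> lists K" and T: "\<And>\<sigma>. \<sigma> \<in> L \<Longrightarrow> seq_tree K (T \<sigma>)"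
  shows "fsigma_in (seq_topology K) (grafted_branches L T)"
proof -
  define C where "C n = {s. prefix n s \<in> L \<and> suffix n s \<in> branches (T (prefix n s))}" for n
  have "closedin (seq_topology K) (C n)" for n
    unfolding closedin_seq_topology_iff
  proof (intro conjI ballI subsetI)
    fix s assume "s \<in> C n"
    then have "prefix n s \<in> lists K" "suffix n s \<in> UNIV \<rightarrow> K"
      using L T branches_in_seqs unfolding C_def by blast+
    then have "prefix n s \<frown> suffix n s \<in> UNIV \<rightarrow> K" by (rule conc_in_seqs)
    then show "s \<in> UNIV \<rightarrow> K" by simp
  next
    fix s assume s: "s \<in> (UNIV \<rightarrow> K) - C n"
    show "\<exists>m. \<forall>t\<in>UNIV \<rightarrow> K. prefix m t = prefix m s \<longrightarrow> t \<notin> C n"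
    proof (cases "prefix n s \<in> L")
      case False
      then show ?thesis by (intro exI[of _ n]) (simp add: C_def)
    next
      case True
      then obtain m where m: "prefix m (suffix n s) \<notin> T (prefix n s)"
        using s by (auto simp: C_def branches_iff)
      \<comment> \<open>The first \<open>n\<close> entries select the same tree as for
        \<open>s\<close>; the next \<open>m\<close> repeat the exit of \<open>s\<close> from that
        tree.\<close>
      have "t \<notin> C n" if t: "prefix (n + m) t = prefix (n + m) s" for t
      proof -
        have "prefix n t = prefix n s" "prefix m (suffix n t) = prefix m (suffix n s)"
          using t unfolding prefix_eq_iff by (auto simp: suffix_def)
        with m have "prefix m (suffix n t) \<notin> T (prefix n t)" by argo
        then show ?thesis unfolding C_def branches_iff by blast
      qed
      then show ?thesis by blast
    qed
  qed
  then have "fsigma_in (seq_topology K) (\<Union>n. C n)"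
    by (intro fsigma_in_Union) (auto intro: closed_imp_fsigma_in)
  moreover have "(\<Union>n. C n) = grafted_branches L T"
    by (auto simp: C_def grafted_branches_def)
  ultimately show ?thesis by simp
qed

section \<open>Ultrafilters and operations on branching trees\<close>

locale ultrafilter_sequences =
  fixes K :: "'a set" and U :: "'a set set"
  assumes ultrafilter: "ultrafilter_over K U"
begin

lemma Int_in: "A \<in> U \<Longrightarrow> B \<in> U \<Longrightarrow> A \<inter> B \<in> U"
  using ultrafilter unfolding ultrafilter_over_def by blast

lemma superset_in: "A \<in> U \<Longrightarrow> A \<subseteq> B \<Longrightarrow> B \<subseteq> K \<Longrightarrow> B \<in> U"
  using ultrafilter unfolding ultrafilter_over_def by blast

lemma whole_in: "K \<in> U"
  using ultrafilter unfolding ultrafilter_over_def by blast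

text \<open>Maximality of the ultrafilter turns "not almost every successor has \<open>P\<close>"
  into "almost every successor fails \<open>P\<close>".\<close>

lemma Collect_not_in: "{\<alpha>\<in>K. P \<alpha>} \<notin> U \<Longrightarrow> {\<alpha>\<in>K. \<not> P \<alpha>} \<in> U"
proof -
  assume "{\<alpha>\<in>K. P \<alpha>} \<notin> U"
  moreover have "A \<subseteq> K \<Longrightarrow> A \<in> U \<or> K - A \<in> U" for A
    using ultrafilter by (simp add: ultrafilter_over_def)
  ultimately have "K - {\<alpha>\<in>K. P \<alpha>} \<in> U"
    by (metis (no_types, lifting) mem_Collect_eq subsetI)
  moreover have "K - {\<alpha>\<in>K. P \<alpha>} = {\<alpha>\<in>K. \<not> P \<alpha>}" by blast
  ultimately show ?thesis by simp
qed

lemma finite_Collect_all_in: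
  assumes "finite I" "\<And>i. i \<in> I \<Longrightarrow> {\<alpha>\<in>K. P i \<alpha>} \<in> U"
  shows "{\<alpha>\<in>K. \<forall>i\<in>I. P i \<alpha>} \<in> U"
  using assms
proof (induction I rule: finite_induct)
  case empty
  then show ?case using whole_in by simp
next
  case (insert i I)
  have "{\<alpha>\<in>K. \<forall>j\<in>insert i I. P j \<alpha>} = {\<alpha>\<in>K. P i \<alpha>} \<inter> {\<alpha>\<in>K. \<forall>j\<in>I. P j \<alpha>}" by blast
  then show ?case using insert Int_in by simp
qed

lemma U_branching_lists: "U_branching K U (lists K)"
  using whole_in by (auto simp: U_branching_def seq_tree_def)

text \<open>Intersect the two witnessing trees: the successor set of a common node is the
  intersection of two members of \<open>U\<close>.\<close>

lemma U_small_Un: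
  assumes "U_small K U X" "U_small K U Y"
  shows "U_small K U (X \<union> Y)"
proof -
  obtain S T where S: "U_branching K U S" "branches S \<inter> X = {}"
    and T: "U_branching K U T" "branches T \<inter> Y = {}"
    using assms unfolding U_small_def by blast
  have "{\<alpha>\<in>K. \<sigma> @ [\<alpha>] \<in> S \<inter> T} \<in> U" if "\<sigma> \<in> S \<inter> T" for \<sigma>
  proof -
    have "{\<alpha>\<in>K. \<sigma> @ [\<alpha>] \<in> S} \<inter> {\<alpha>\<in>K. \<sigma> @ [\<alpha>] \<in> T} \<in> U"
      using that S(1) T(1) by (intro Int_in) (auto simp: U_branching_def)
    then show ?thesis by (rule superset_in) auto
  qed
  then have "U_branching K U (S \<inter> T)"
    using S(1) T(1) unfolding U_branching_def seq_tree_def by blast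
  moreover have "branches (S \<inter> T) \<inter> (X \<union> Y) = {}"
    using S(2) T(2) by (auto simp: branches_def)
  ultimately show ?thesis unfolding U_small_def by blast
qed

text \<open>Choose a witness tree for each \<open>\<alpha>\<close> in the given set and hang it
  below the node \<open>[\<alpha>]\<close>. The successor set of the new root is then exactly the
  given set.\<close>

lemma U_large_glue_root:
  assumes "{\<alpha>\<in>K. U_large K U (section_at X [\<alpha>])} \<in> U" (is "?A \<in> U")
  shows "U_large K U X"
proof -
  obtain T where T: "\<And>\<alpha>. \<alpha> \<in> ?A \<Longrightarrow> U_branching K U (T \<alpha>) \<and> branches (T \<alpha>) \<subseteq> section_at X [\<alpha>]"
    using bchoice[of ?A "\<lambda>\<alpha> T. U_branching K U T \<and> branches T \<subseteq> section_at X [\<alpha>]"]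
    unfolding U_large_def by blast
  define S where "S = insert [] {\<alpha> # \<tau> | \<alpha> \<tau>. \<alpha> \<in> ?A \<and> \<tau> \<in> T \<alpha>}"
  have Cons_in_S: "\<alpha> # \<tau> \<in> S \<longleftrightarrow> \<alpha> \<in> ?A \<and> \<tau> \<in> T \<alpha>" for \<alpha> \<tau>
    by (auto simp: S_def)
  have tree: "T \<alpha> \<subseteq> lists K" "\<sigma> @ \<tau> \<in> T \<alpha> \<Longrightarrow> \<sigma> \<in> T \<alpha>" "[] \<in> T \<alpha>"
    "\<sigma> \<in> T \<alpha> \<Longrightarrow> {\<beta>\<in>K. \<sigma> @ [\<beta>] \<in> T \<alpha>} \<in> U" if "\<alpha> \<in> ?A" for \<alpha> \<sigma> \<tau>
    using T[OF that] unfolding U_branching_def seq_tree_def by blast+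
  have "U_branching K U S"
    unfolding U_branching_def seq_tree_def
  proof (intro conjI allI impI ballI)
    show "S \<subseteq> lists K" using tree(1) by (fastforce simp: S_def)
    show "[] \<in> S" by (simp add: S_def)
  next
    fix \<sigma> \<tau> assume "\<sigma> @ \<tau> \<in> S"
    then show "\<sigma> \<in> S"
      using tree(2) by (cases \<sigma>) (auto simp: Cons_in_S S_def)
  next
    fix \<sigma> assume \<sigma>: "\<sigma> \<in> S"
    show "{\<alpha>\<in>K. \<sigma> @ [\<alpha>] \<in> S} \<in> U"
    proof (cases \<sigma>)
      case Nil
      have "{\<alpha>\<in>K. \<sigma> @ [\<alpha>] \<in> S} = ?A"
        using tree(3) by (auto simp: Nil Cons_in_S)
      with assms show ?thesis by simp
    next
      case (Cons \<alpha> \<tau>)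
      then show ?thesis using \<sigma> tree(4)[of \<alpha> \<tau>] by (simp add: Cons_in_S)
    qed
  qed
  moreover have "branches S \<subseteq> X"
  proof
    fix s assume "s \<in> branches S"
    then have "prefix (Suc n) s \<in> S" for n unfolding branches_iff by blast
    moreover have "prefix (Suc n) s = s 0 # prefix n (suffix 1 s)" for n
      by (simp add: subsequence_def suffix_def upt_conv_Cons map_Suc_upt[symmetric] del: upt_Suc)
    ultimately have s: "s 0 \<in> ?A \<and> prefix n (suffix 1 s) \<in> T (s 0)" for n
      using Cons_in_S by metis
    then have "suffix 1 s \<in> section_at X [s 0]"
      using T[of "s 0"] by (auto simp: branches_iff)
    moreover have "[s 0] \<frown> suffix 1 s = s"
      by (auto simp: conc_def suffix_def)
    ultimately show "s \<in> X" by (simp add: section_at_def)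
  qed
  ultimately show ?thesis unfolding U_large_def by blast
qed

lemma U_large_glue:
  "{\<alpha>\<in>K. U_large K U (section_at X (\<sigma> @ [\<alpha>]))} \<in> U \<Longrightarrow> U_large K U (section_at X \<sigma>)"
  by (rule U_large_glue_root) (simp add: section_at_append)

lemma U_small_glue:
  "{\<alpha>\<in>K. U_small K U (section_at X (\<sigma> @ [\<alpha>]))} \<in> U \<Longrightarrow> U_small K U (section_at X \<sigma>)"
  using U_large_glue[of "- X" \<sigma>] by (simp add: U_small_iff_large_Compl section_at_Compl)

section \<open>The fusion construction\<close>

text \<open>By \<open>glue\<close>, a node failing \<open>P\<close> has almost all successors
  failing \<open>P\<close>. The tree \<open>S k\<close> is imposed only below the node of length
  \<open>k\<close>, so a node of length \<open>n\<close> meets just \<open>n + 1\<close> tree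
  conditions, and finite intersections suffice.\<close>

lemma fusion_tree:
  assumes root: "\<not> P []"
    and glue: "\<And>\<sigma>. {\<alpha>\<in>K. P (\<sigma> @ [\<alpha>])} \<in> U \<Longrightarrow> P \<sigma>"
    and S: "\<And>k \<sigma>. U_branching K U (S k \<sigma>)"
  obtains T where "U_branching K U T"
    and "\<And>s k. s \<in> branches T \<Longrightarrow> \<not> P (prefix k s) \<and> suffix k s \<in> branches (S k (prefix k s))"
proof -
  \<comment> \<open>The index \<open>k = length \<sigma>\<close> is included: it says that
    \<open>P\<close> fails at \<open>\<sigma>\<close> itself, and its tree condition is only that
    \<open>[]\<close> belongs to the tree.\<close>
  define T where "T = {\<sigma> \<in> lists K. \<forall>k\<in>{..length \<sigma>}. \<not> P (take k \<sigma>) \<and> drop k \<sigma> \<in> S k (take k \<sigma>)}"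
  have S': "[] \<in> S k \<sigma>" "\<rho> @ \<tau> \<in> S k \<sigma> \<Longrightarrow> \<rho> \<in> S k \<sigma>"
    "\<rho> \<in> S k \<sigma> \<Longrightarrow> {\<alpha>\<in>K. \<rho> @ [\<alpha>] \<in> S k \<sigma>} \<in> U" for k \<sigma> \<rho> \<tau>
    using S[of k \<sigma>] unfolding U_branching_def seq_tree_def by blast+
  have "U_branching K U T"
    unfolding U_branching_def seq_tree_def
  proof (intro conjI allI impI ballI)
    show "T \<subseteq> lists K" by (auto simp: T_def)
    show "[] \<in> T" using root S'(1) by (simp add: T_def)
  next
    fix \<sigma> \<tau> assume a: "\<sigma> @ \<tau> \<in> T"
    have "\<not> P (take k \<sigma>) \<and> drop k \<sigma> \<in> S k (take k \<sigma>)" if "k \<le> length \<sigma>" for k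
    proof -
      have "\<not> P (take k (\<sigma> @ \<tau>)) \<and> drop k (\<sigma> @ \<tau>) \<in> S k (take k (\<sigma> @ \<tau>))"
        using a that unfolding T_def mem_Collect_eq by (metis atMost_iff le_add1 le_trans length_append)
      then show ?thesis using that S'(2) by auto
    qed
    then show "\<sigma> \<in> T" using a by (auto simp: T_def)
  next
    fix \<sigma> assume \<sigma>: "\<sigma> \<in> T"
    let ?n = "length \<sigma>"
    have "\<not> P (take ?n \<sigma>)" using \<sigma> unfolding T_def by blast
    then have "{\<alpha>\<in>K. \<not> P (\<sigma> @ [\<alpha>])} \<in> U"
      using glue by (intro Collect_not_in) auto
    moreover have "{\<alpha>\<in>K. \<forall>k\<in>{..?n}. drop k \<sigma> @ [\<alpha>] \<in> S k (take k \<sigma>)} \<in> U"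
      using \<sigma> S'(3) by (intro finite_Collect_all_in) (auto simp: T_def)
    ultimately have "{\<alpha>\<in>K. \<not> P (\<sigma> @ [\<alpha>])} \<inter> {\<alpha>\<in>K. \<forall>k\<in>{..?n}. drop k \<sigma> @ [\<alpha>] \<in> S k (take k \<sigma>)} \<in> U"
      by (rule Int_in)
    \<comment> \<open>Passing to \<open>\<sigma> @ [\<alpha>]\<close> adds the index
      \<open>Suc ?n\<close>. Its \<open>P\<close> part is the first set above, and its tree part
      holds because \<open>[]\<close> lies in every tree.\<close>
    then show "{\<alpha>\<in>K. \<sigma> @ [\<alpha>] \<in> T} \<in> U"
      by (rule superset_in) (use \<sigma> S'(1) in \<open>auto simp: T_def atMost_Suc\<close>)
  qed
  moreover have "\<not> P (prefix k s) \<and> suffix k s \<in> branches (S k (prefix k s))"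
    if s: "s \<in> branches T" for s k
  proof -
    have "\<not> P (prefix k s) \<and> prefix m (suffix k s) \<in> S k (prefix k s)" for m
    proof -
      have "prefix (k + m) s \<in> T" using s by (simp add: branches_iff)
      moreover have "take k (prefix (k + m) s) = prefix k s"
        by (simp add: subsequence_def take_map)
      moreover have "drop k (prefix (k + m) s) = prefix m (suffix k s)"
        by (rule nth_equalityI) (auto simp: subsequence_def suffix_def)
      moreover have "k \<in> {..length (prefix (k + m) s)}" by simp
      ultimately show ?thesis unfolding T_def by auto
    qed
    then show ?thesis by (simp add: branches_iff)
  qed
  ultimately show thesis by (rule that)
qed

section \<open>Measurability of closed and F-sigma sets\<close>

text \<open>If a section is not small, fusion gives a tree all of whose branches pass only through
  nodes with non-small sections. A branch leaving the closed set would pass through a node whose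
  section is empty, hence small.\<close>

lemma closedin_U_measurable:
  assumes "closedin (seq_topology K) C"
  shows "U_measurable K U C"
  unfolding U_measurable_def U_determined_def
proof (intro ballI disjCI)
  fix \<sigma> assume \<sigma>: "\<sigma> \<in> lists K" and ns: "\<not> U_small K U (section_at C \<sigma>)"
  let ?P = "\<lambda>\<tau>. U_small K U (section_at C (\<sigma> @ \<tau>))"
  obtain T where T: "U_branching K U T" "\<And>s k. s \<in> branches T \<Longrightarrow> \<not> ?P (prefix k s)"
  \<comment> \<open>With the full tree at every node the tree conditions are vacuous; only
    non-smallness is propagated.\<close>
  proof (rule fusion_tree[of ?P "\<lambda>_ _. lists K"])
    show "\<not> ?P []" using ns by simp
    show "?P \<tau>" if "{\<alpha>\<in>K. ?P (\<tau> @ [\<alpha>])} \<in> U" for \<tau>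
      using that U_small_glue[of C "\<sigma> @ \<tau>"] by simp
  qed (use U_branching_lists in auto)
  have "s \<in> section_at C \<sigma>" if s: "s \<in> branches T" for s
  proof (rule ccontr)
    assume n: "s \<notin> section_at C \<sigma>"
    have "s \<in> UNIV \<rightarrow> K" using branches_in_seqs s T(1) unfolding U_branching_def by blast
    then have "\<sigma> \<frown> s \<in> (UNIV \<rightarrow> K) - C" using n conc_in_seqs[OF \<sigma>] by (auto simp: section_at_def)
    then obtain m where m: "\<And>t. t \<in> UNIV \<rightarrow> K \<Longrightarrow> prefix m t = prefix m (\<sigma> \<frown> s) \<Longrightarrow> t \<notin> C"
      using assms unfolding closedin_seq_topology_iff by blast
    \<comment> \<open>The node \<open>\<sigma> @ prefix m s\<close> has at least \<open>m\<close>
      entries, so all its extensions agree with \<open>\<sigma> \<frown> s\<close> below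
      \<open>m\<close>.\<close>
    have "t \<notin> section_at C (\<sigma> @ prefix m s)" for t
    proof
      assume "t \<in> section_at C (\<sigma> @ prefix m s)"
      then have t: "\<sigma> \<frown> prefix m s \<frown> t \<in> C" by (simp add: section_at_def)
      moreover have "C \<subseteq> UNIV \<rightarrow> K" using closedin_subset[OF assms] by simp
      moreover have "prefix m (\<sigma> \<frown> prefix m s \<frown> t) = prefix m (\<sigma> \<frown> s)"
        unfolding prefix_eq_iff by (auto simp: conc_def subsequence_def)
      ultimately show False using m by blast
    qed
    then have "section_at C (\<sigma> @ prefix m s) = {}" by blast
    then have "?P (prefix m s)" using T(1) by (auto simp: U_small_def)
    with T(2) s show False by blast
  qed
  then show "U_large K U (section_at C \<sigma>)" using T(1) unfolding U_large_def by blast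
qed

text \<open>The index of a closed piece is matched with a level of the tree: a branch in the piece
  \<open>C k\<close> would have its tail from \<open>k\<close> on in a section that the tree
  attached at level \<open>k\<close> avoids.\<close>

lemma fsigma_in_U_measurable:
  assumes "fsigma_in (seq_topology K) Z"
  shows "U_measurable K U Z"
  unfolding U_measurable_def U_determined_def
proof (intro ballI, subst disj_commute, rule disjCI)
  fix \<sigma> assume \<sigma>: "\<sigma> \<in> lists K" and nl: "\<not> U_large K U (section_at Z \<sigma>)"
  obtain C :: "nat \<Rightarrow> (nat \<Rightarrow> 'a) set" where C: "\<And>n. closedin (seq_topology K) (C n)" "(\<Union>n. C n) = Z"
    using assms unfolding fsigma_in_ascending by blast
  \<comment> \<open>The guard makes \<open>\<not> ?P \<tau>\<close> include
    \<open>\<tau> \<in> lists K\<close>, which is needed to apply measurability of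
    \<open>C k\<close> at \<open>\<sigma> @ \<tau>\<close>.\<close>
  let ?P = "\<lambda>\<tau>. \<tau> \<in> lists K \<longrightarrow> U_large K U (section_at Z (\<sigma> @ \<tau>))"
  \<comment> \<open>Fusion asks for a branching tree at every node; where \<open>?P\<close> holds,
    any such tree serves, for example \<open>lists K\<close>.\<close>
  let ?S = "\<lambda>k \<tau> S. U_branching K U S \<and> (\<not> ?P \<tau> \<longrightarrow> branches S \<inter> section_at (C k) (\<sigma> @ \<tau>) = {})"
  define S where "S k \<tau> = (SOME S. ?S k \<tau> S)" for k \<tau>
  have "\<exists>S. ?S k \<tau> S" for k \<tau>
  proof (cases "?P \<tau>")
    case True
    then show ?thesis using U_branching_lists by blast
  next
    case False
    then have "\<not> U_large K U (section_at (C k) (\<sigma> @ \<tau>))"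
      using U_large_mono[OF _ section_at_mono] C(2) by blast
    moreover have "\<sigma> @ \<tau> \<in> lists K" using False \<sigma> by simp
    ultimately have "U_small K U (section_at (C k) (\<sigma> @ \<tau>))"
      using closedin_U_measurable[OF C(1)] unfolding U_measurable_def U_determined_def by blast
    then show ?thesis unfolding U_small_def by blast
  qed
  then have "?S k \<tau> (S k \<tau>)" for k \<tau>
    unfolding S_def by (rule someI_ex)
  then have S: "U_branching K U (S k \<tau>)"
    "\<not> ?P \<tau> \<Longrightarrow> branches (S k \<tau>) \<inter> section_at (C k) (\<sigma> @ \<tau>) = {}" for k \<tau>
    by blast+
  have glue: "?P \<tau>" if "{\<alpha>\<in>K. ?P (\<tau> @ [\<alpha>])} \<in> U" for \<tau>
  proof
    assume "\<tau> \<in> lists K"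
    then have "{\<alpha>\<in>K. U_large K U (section_at Z ((\<sigma> @ \<tau>) @ [\<alpha>]))} \<in> U"
      using that by (elim superset_in) auto
    then show "U_large K U (section_at Z (\<sigma> @ \<tau>))" by (rule U_large_glue)
  qed
  obtain T where T: "U_branching K U T"
    "\<And>s k. s \<in> branches T \<Longrightarrow> \<not> ?P (prefix k s) \<and> suffix k s \<in> branches (S k (prefix k s))"
    by (rule fusion_tree[of ?P S]) (use nl glue S(1) in auto)
  have "s \<notin> section_at Z \<sigma>" if s: "s \<in> branches T" for s
  proof
    assume "s \<in> section_at Z \<sigma>"
    then obtain k where "\<sigma> \<frown> s \<in> C k" using C(2) by (auto simp: section_at_def)
    then have "suffix k s \<in> section_at (C k) (\<sigma> @ prefix k s)"
      by (simp add: section_at_def flip: conc_conc)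
    with T(2)[OF s, of k] S(2)[of "prefix k s" k] show False by blast
  qed
  then show "U_small K U (section_at Z \<sigma>)" using T(1) unfolding U_small_def by blast
qed

section \<open>Approximation from inside and outside\<close>

text \<open>Grafting witness trees at all nodes with large sections keeps every one of these
  sections large. As \<open>X\<close> is arbitrary, this also applies to \<open>- X\<close>; the
  kernel still consists of sequences from \<open>K\<close>, because branches do.\<close>

lemma fsigma_kernel:
  obtains Z where "Z \<subseteq> X" "fsigma_in (seq_topology K) Z"
    and "\<And>\<sigma>. \<sigma> \<in> lists K \<Longrightarrow> U_large K U (section_at X \<sigma>) \<Longrightarrow> U_large K U (section_at Z \<sigma>)"
proof -
  define L where "L = {\<sigma> \<in> lists K. U_large K U (section_at X \<sigma>)}"
  obtain T where T: "\<And>\<sigma>. \<sigma> \<in> L \<Longrightarrow> U_branching K U (T \<sigma>) \<and> branches (T \<sigma>) \<subseteq> section_at X \<sigma>"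
    using bchoice[of L "\<lambda>\<sigma> T. U_branching K U T \<and> branches T \<subseteq> section_at X \<sigma>"]
    unfolding U_large_def L_def by blast
  show thesis
  proof (rule that[of "grafted_branches L T"])
    show "grafted_branches L T \<subseteq> X" using T by (intro grafted_branches_subset) blast
    show "fsigma_in (seq_topology K) (grafted_branches L T)"
      using T by (intro fsigma_in_grafted_branches) (auto simp: L_def U_branching_def)
    show "U_large K U (section_at (grafted_branches L T) \<sigma>)"
      if "\<sigma> \<in> lists K" "U_large K U (section_at X \<sigma>)" for \<sigma>
      using that T branches_subset_section_grafted[of \<sigma> L T] unfolding U_large_def L_def by blast
  qed
qed

end

theorem theorem5p9:
  fixes \<kappa> :: "'a rel" and U :: "'a set set" and X :: "(nat \<Rightarrow> 'a) set"
  assumes "Card_order \<kappa>"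
    and "ultrafilter_over (Field \<kappa>) U"
    and "X \<subseteq> (UNIV \<rightarrow> Field \<kappa>)"
  shows "U_measurable (Field \<kappa>) U X \<longleftrightarrow>
    (\<exists>Z Y. Z \<subseteq> X \<and> X \<subseteq> Y \<and>
       fsigma_in (seq_topology (Field \<kappa>)) Z \<and>
       gdelta_in (seq_topology (Field \<kappa>)) Y \<and>
       U_null (Field \<kappa>) U (Y - Z))"
    (is "_ \<longleftrightarrow> ?R")
proof
  let ?K = "Field \<kappa>"
  interpret ultrafilter_sequences ?K U by standard (rule assms)
  {
    assume meas: "U_measurable ?K U X"
    obtain Z where Z: "Z \<subseteq> X" "fsigma_in (seq_topology ?K) Z"
      "\<And>\<sigma>. \<sigma> \<in> lists ?K \<Longrightarrow> U_large ?K U (section_at X \<sigma>) \<Longrightarrow> U_large ?K U (section_at Z \<sigma>)"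
      using fsigma_kernel[of X] by blast
    obtain V where V: "V \<subseteq> - X" "fsigma_in (seq_topology ?K) V"
      "\<And>\<sigma>. \<sigma> \<in> lists ?K \<Longrightarrow> U_large ?K U (section_at (- X) \<sigma>) \<Longrightarrow> U_large ?K U (section_at V \<sigma>)"
      using fsigma_kernel[of "- X"] by blast
    \<comment> \<open>The outer set is the complement, within the sequence space, of the kernel of
      \<open>- X\<close>.\<close>
    let ?Y = "(UNIV \<rightarrow> ?K) - V"
    have "V \<subseteq> (UNIV \<rightarrow> ?K)" using fsigma_in_subset[OF V(2)] by simp
    then have "gdelta_in (seq_topology ?K) ?Y"
      using V(2) by (simp add: gdelta_in_fsigma_in double_diff)
    moreover have "U_null ?K U (?Y - Z)"
      unfolding U_null_def
    proof
      fix \<sigma> assume \<sigma>: "\<sigma> \<in> lists ?K"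
      \<comment> \<open>A large section of \<open>X\<close> makes that of \<open>Z\<close> large, a
        small one makes that of \<open>V\<close> large. Both \<open>Z\<close> and \<open>V\<close>
        are disjoint from \<open>?Y - Z\<close>.\<close>
      then have "U_large ?K U (section_at Z \<sigma>) \<or> U_large ?K U (section_at V \<sigma>)"
        using meas Z(3) V(3)
        by (auto simp: U_measurable_def U_determined_def U_small_iff_large_Compl section_at_Compl)
      then have "U_large ?K U (section_at (- (?Y - Z)) \<sigma>)"
        by (rule disjE) (erule U_large_mono, force simp: section_at_def)+
      then show "U_small ?K U (section_at (?Y - Z) \<sigma>)"
        by (simp only: U_small_iff_large_Compl section_at_Compl)
    qed
    ultimately show ?R using Z V(1) assms(3) by (intro exI[of _ Z] exI[of _ ?Y]) blast
  }
  assume ?R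
  then obtain Z Y where ZY: "Z \<subseteq> X" "X \<subseteq> Y" "fsigma_in (seq_topology ?K) Z" "U_null ?K U (Y - Z)"
    by blast
  show "U_measurable ?K U X"
    unfolding U_measurable_def U_determined_def
  proof
    fix \<sigma> assume \<sigma>: "\<sigma> \<in> lists ?K"
    then consider "U_large ?K U (section_at Z \<sigma>)" | "U_small ?K U (section_at Z \<sigma>)"
      using fsigma_in_U_measurable[OF ZY(3)] unfolding U_measurable_def U_determined_def by blast
    then show "U_large ?K U (section_at X \<sigma>) \<or> U_small ?K U (section_at X \<sigma>)"
    proof cases
      case 1
      then show ?thesis using U_large_mono[OF _ section_at_mono[OF ZY(1)]] by blast
    next
      case 2
      moreover have "U_small ?K U (section_at (Y - Z) \<sigma>)"
        using ZY(4) \<sigma> unfolding U_null_def by blast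
      \<comment> \<open>This union covers the section of \<open>X\<close>, because
        \<open>X \<subseteq> Y \<subseteq> Z \<union> (Y - Z)\<close>.\<close>
      ultimately have "U_small ?K U (section_at Z \<sigma> \<union> section_at (Y - Z) \<sigma>)" by (rule U_small_Un)
      then have "U_small ?K U (section_at X \<sigma>)"
        by (rule U_small_mono) (use ZY(2) in \<open>auto simp: section_at_def\<close>)
      then show ?thesis ..
    qed
  qed
qed

end
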